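(* Let $P=\{x\in\mathbb R^n \mid L_i(x)\ge 0,\ i=1,\dots,m\}$ be a convex, compact polyhedron with non-empty interior, where $L_1,\dots,L_m\in\mathbb R[X]=\mathbb R[X_1,\dots,X_n]$ are linear (degree one, not necessarily homogeneous) polynomials normalized so that $\sum_{i=1}^m L_i(X)=1$. Let $\mathbf F\in\mathcal S_t(\mathbb R[X])$ be a symmetric polynomial matrix of positive degree which is positive definite on $P$. Let $\overline{\mathbf F}=\widetilde{\mathbf F}+cR\,\mathbf I_t\in\mathcal S_t(\mathbb R[Y])$ and its homogenization $\overline{\mathbf F}^h$ be as defined in the context, where $c$ is a constant such that $\widetilde{\mathbf F}+cR\,\mathbf I_t\succ \mathbf 0$ on $\Delta_m$. Assume that $\overline{\mathbf F}^h\succcurlyeq\lambda \mathbf I_t$ on $\Delta_m$ for some $\lambda>0$. Let $d:=\deg(\overline{\mathbf F})$ and $C:=C(\overline{\mathbf F}^h)$. Then for each non-negative integer $N>\frac{d(d-1)}{2}\frac{C}{\lambda}-d$, the matrix $\mathbf F$ can be represented as $$\mathbf F=\sum_{\alpha\in\mathbb N^m,\ |\alpha|=N+d}\mathbf F_\alpha L_1^{\alpha_1}\cdots L_m^{\alpha_m},$$ where each $\mathbf F_\alpha\in\mathcal S_t(\mathbb R)$ is positive definite.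
   Context: Notation. $\mathcal M_t(S)$ is the ring of $t\times t$ matrices over a commutative ring $S$ and $\mathcal S_t(S)$ its subset of symmetric matrices; $\mathbf I_t$ is the identity matrix. The degree of a polynomial matrix is the maximum of the degrees of its entries. For a set $K$, $\mathbf A\succ\mathbf 0$ (resp. $\mathbf A\succcurlyeq\mathbf 0$) on $K$ means that $\mathbf A(x)$ is positive definite (resp. positive semidefinite) for every $x\in K$, and $\mathbf A\succcurlyeq\mathbf B$ on $K$ means $\mathbf A-\mathbf B\succcurlyeq\mathbf 0$ on $K$. For $\alpha\in\mathbb N^k$, $|\alpha|=\alpha_1+\cdots+\alpha_k$. $\Delta_m=\{y\in\mathbb R^m\mid y_i\ge0,\ \sum_{i=1}^m y_i=1\}$ is the standard simplex. Setting. $\mathbf B=(b_{ij})$ is a real $n\times m$ matrix such that $X_i=\sum_{j=1}^m b_{ij}L_j(X)$ for $i=1,\dots,n$ (such a matrix exists). Put $\mathbb R[Y]=\mathbb R[Y_1,\dots,Y_m]$ and let $\varphi:\mathbb R[Y]\to\mathbb R[X]$ be the $\mathbb R$-algebra homomorphism with $\varphi(Y_i)=L_i(X)$. Let $R_1,\dots,R_s\in\mathbb R[Y]$ be generators of the ideal $\operatorname{Ker}(\varphi)$, one of which is $\sum_{i=1}^m Y_i-1$, and let $R:=\sum_{i=1}^s R_i^2$. Writing $d_{\mathbf F}=\deg\mathbf F$ and $\mathbf F=\sum_{|\alpha|\le d_{\mathbf F}}\mathbf A_\alpha X^\alpha$ with $\mathbf A_\alpha\in\mathcal S_t(\mathbb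 R)$, define $$\widetilde{\mathbf F}(Y):=\sum_{|\alpha|\le d_{\mathbf F}}\mathbf A_\alpha\,(Y\mathbf B^T)^\alpha\Big(\sum_{i=1}^m Y_i\Big)^{d_{\mathbf F}-|\alpha|}\in\mathcal S_t(\mathbb R[Y]),$$ where $Y=(Y_1,\dots,Y_m)$ is a row vector; it is homogeneous of degree $d_{\mathbf F}$. There exists a constant $c$ with $\widetilde{\mathbf F}+cR\,\mathbf I_t\succ\mathbf 0$ on $\Delta_m$; fix such a $c$ and put $\overline{\mathbf F}:=\widetilde{\mathbf F}+cR\,\mathbf I_t$. With $d=\deg\overline{\mathbf F}$ and $\overline{\mathbf F}=\sum_{|\beta|\le d}\overline{\mathbf F}_\beta Y^\beta$, $\overline{\mathbf F}_\beta\in\mathcal S_t(\mathbb R)$, the homogenization is $$\overline{\mathbf F}^h:=\sum_{|\beta|\le d}\overline{\mathbf F}_\beta Y^\beta\Big(\sum_{i=1}^m Y_i\Big)^{d-|\beta|}.$$ For a polynomial matrix $\mathbf G$ of degree $d$ in $k$ variables, $$C(\mathbf G):=\max_{\alpha\in\mathbb N^k,\ |\alpha|\le d}\frac{\|D_\alpha\mathbf G(0)\|}{|\alpha|!},$$ where $D_\alpha=\partial_1^{\alpha_1}\cdots\partial_k^{\alpha_k}$ acts entrywise, $\|\cdot\|$ is the spectral norm and $|\alpha|!$ is the factorial of the integer $|\alpha|$. *)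

theory Defs
  imports "HOL-Analysis.Analysis" "HOL-Library.Poly_Mapping"
begin

text \<open>
  Variables are indexed by a finite type \<open>'v\<close>. An exponent is a map \<open>'v \<Rightarrow>\<^sub>0 nat\<close> and a real
  polynomial is a finitely supported map from exponents to coefficients; the product provided
  by Poly_Mapping is the convolution product, i.e. the product of polynomials.
\<close>

type_synonym 'v mpoly = "('v \<Rightarrow>\<^sub>0 nat) \<Rightarrow>\<^sub>0 real"

definition Const :: "real \<Rightarrow> 'v mpoly" where
  "Const a = Poly_Mapping.single 0 a"

definition pvar :: "'v \<Rightarrow> 'v mpoly" where
  "pvar i = Poly_Mapping.single (Poly_Mapping.single i 1) 1"

definition coeff :: "'v mpoly \<Rightarrow> ('v \<Rightarrow>\<^sub>0 nat) \<Rightarrow> real" where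
  "coeff p \<alpha> = Poly_Mapping.lookup p \<alpha>"

definition expo_deg :: "('v::finite \<Rightarrow>\<^sub>0 nat) \<Rightarrow> nat" where
  "expo_deg \<alpha> = (\<Sum>i\<in>UNIV. Poly_Mapping.lookup \<alpha> i)"

text \<open>The multi-index power \<open>v\<^sub>1^\<alpha>\<^sub>1 \<cdots> v\<^sub>k^\<alpha>\<^sub>k\<close> of a vector over any commutative semiring.\<close>

definition mpow :: "('a::comm_semiring_1) ^ 'v \<Rightarrow> ('v::finite \<Rightarrow>\<^sub>0 nat) \<Rightarrow> 'a" where
  "mpow v \<alpha> = (\<Prod>i\<in>UNIV. (v $ i) ^ Poly_Mapping.lookup \<alpha> i)"

definition eval_poly :: "'v::finite mpoly \<Rightarrow> real ^ 'v \<Rightarrow> real" where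
  "eval_poly p x = (\<Sum>\<alpha>\<in>Poly_Mapping.keys p. coeff p \<alpha> * mpow x \<alpha>)"

text \<open>The algebra homomorphism sending the variable \<open>Y\<^sub>i\<close> to \<open>L\<^sub>i\<close>.\<close>

definition subst_poly :: "'w mpoly ^ 'v \<Rightarrow> 'v::finite mpoly \<Rightarrow> 'w mpoly" where
  "subst_poly L p = (\<Sum>\<alpha>\<in>Poly_Mapping.keys p. Const (coeff p \<alpha>) * mpow L \<alpha>)"

text \<open>The zero polynomial gets total degree 0.\<close>

definition total_deg :: "'v::finite mpoly \<Rightarrow> nat" where
  "total_deg p = Max (insert 0 (expo_deg ` Poly_Mapping.keys p))"

definition partial :: "'v \<Rightarrow> 'v mpoly \<Rightarrow> 'v mpoly" where
  "partial i p = (\<Sum>\<alpha>\<in>Poly_Mapping.keys p.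
     Poly_Mapping.single (\<alpha> - Poly_Mapping.single i 1) (coeff p \<alpha> * real (Poly_Mapping.lookup \<alpha> i)))"

text \<open>
  \<open>D\<^sub>\<alpha> = \<partial>\<^sub>1^\<alpha>\<^sub>1 \<cdots> \<partial>\<^sub>k^\<alpha>\<^sub>k\<close>. The variables carry no order, so the composition is a fold over the set
  of all variables; \<open>comp_fun_commute_partial\<close> below shows that the order does not matter.
\<close>

definition D_multi :: "('v::finite \<Rightarrow>\<^sub>0 nat) \<Rightarrow> 'v mpoly \<Rightarrow> 'v mpoly" where
  "D_multi \<alpha> p = Finite_Set.fold (\<lambda>i. partial i ^^ Poly_Mapping.lookup \<alpha> i) p UNIV"

definition ideal_gen :: "'v mpoly set \<Rightarrow> 'v mpoly set" where
  "ideal_gen S = module.span (*) S"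

lemma finite_expo_deg_le: "finite {\<alpha> :: 'v::finite \<Rightarrow>\<^sub>0 nat. expo_deg \<alpha> \<le> d}"
proof -
  have "Poly_Mapping.lookup ` {\<alpha> :: 'v \<Rightarrow>\<^sub>0 nat. expo_deg \<alpha> \<le> d} \<subseteq> UNIV \<rightarrow>\<^sub>E {..d}"
  proof -
    have "Poly_Mapping.lookup \<alpha> i \<le> expo_deg \<alpha>" for \<alpha> :: "'v \<Rightarrow>\<^sub>0 nat" and i
      unfolding expo_deg_def by (rule member_le_sum) auto
    then show ?thesis by (fastforce simp: PiE_def intro: le_trans)
  qed
  moreover have "finite ((UNIV :: 'v set) \<rightarrow>\<^sub>E {..d})" by (intro finite_PiE) auto
  ultimately have "finite (Poly_Mapping.lookup ` {\<alpha> :: 'v \<Rightarrow>\<^sub>0 nat. expo_deg \<alpha> \<le> d})"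
    by (rule finite_subset)
  then show ?thesis
    by (rule finite_imageD) (simp add: inj_on_def poly_mapping_eqI)
qed

lemma module_mpoly: "module ((*) :: 'v mpoly \<Rightarrow> 'v mpoly \<Rightarrow> 'v mpoly)"
  by unfold_locales (simp_all add: algebra_simps)

lemma coeff_partial:
  "coeff (partial i p) \<beta> = real (Poly_Mapping.lookup \<beta> i + 1) * coeff p (\<beta> + Poly_Mapping.single i 1)"
proof -
  let ?e = "Poly_Mapping.single i (1::nat)"
  let ?f = "\<lambda>\<alpha>. coeff p \<alpha> * real (Poly_Mapping.lookup \<alpha> i)"
  have sh: "\<alpha> = \<beta> + ?e" if "\<alpha> - ?e = \<beta>" "Poly_Mapping.lookup \<alpha> i \<noteq> 0" for \<alpha>
    using that by (auto intro!: poly_mapping_eqI simp: lookup_add lookup_minus lookup_single when_def)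
  have "coeff (partial i p) \<beta> = (\<Sum>\<alpha>\<in>Poly_Mapping.keys p. ?f \<alpha> when \<alpha> - ?e = \<beta>)"
    by (simp add: coeff_def partial_def lookup_sum lookup_single)
  also have "\<dots> = (\<Sum>\<alpha>\<in>Poly_Mapping.keys p. if \<alpha> = \<beta> + ?e then ?f \<alpha> else 0)"
    by (rule sum.cong) (use sh in \<open>auto simp: when_def\<close>)
  also have "\<dots> = (if \<beta> + ?e \<in> Poly_Mapping.keys p then ?f (\<beta> + ?e) else 0)"
    by (simp add: sum.delta)
  also have "\<dots> = ?f (\<beta> + ?e)"
    by (auto simp: coeff_def in_keys_iff)
  finally show ?thesis by (simp add: lookup_add mult.commute)
qed

lemma partial_commute: "partial i (partial j p) = partial j (partial i p)"
proof (rule poly_mapping_eqI)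
  fix \<beta>
  show "Poly_Mapping.lookup (partial i (partial j p)) \<beta> = Poly_Mapping.lookup (partial j (partial i p)) \<beta>"
    unfolding coeff_def[symmetric] coeff_partial
    by (cases "i = j") (simp_all add: lookup_add lookup_single when_def add_ac)
qed

lemma comp_fun_commute_partial:
  fixes \<alpha> :: "'v \<Rightarrow>\<^sub>0 nat"
  shows "comp_fun_commute (\<lambda>i. partial i ^^ Poly_Mapping.lookup \<alpha> i)"
proof
  fix i j :: 'v
  have 1: "partial i ((partial j ^^ k) p) = (partial j ^^ k) (partial i p)" for k and p :: "'v mpoly"
    by (induction k) (simp_all add: partial_commute[of i j])
  have "(partial i ^^ l) ((partial j ^^ k) p) = (partial j ^^ k) ((partial i ^^ l) p)" for k l and p :: "'v mpoly"
    by (induction l) (simp_all add: 1)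
  then show "(partial j ^^ Poly_Mapping.lookup \<alpha> j) \<circ> (partial i ^^ Poly_Mapping.lookup \<alpha> i) =
     (partial i ^^ Poly_Mapping.lookup \<alpha> i) \<circ> (partial j ^^ Poly_Mapping.lookup \<alpha> j)"
    by (simp add: fun_eq_iff)
qed

definition sym_mat :: "'a ^ 't ^ 't \<Rightarrow> bool" where
  "sym_mat A \<longleftrightarrow> transpose A = A"

definition pos_def :: "real ^ 't ^ 't \<Rightarrow> bool" where
  "pos_def A \<longleftrightarrow> sym_mat A \<and> (\<forall>v. v \<noteq> 0 \<longrightarrow> v \<bullet> (A *v v) > 0)"

definition pos_semidef :: "real ^ 't ^ 't \<Rightarrow> bool" where
  "pos_semidef A \<longleftrightarrow> sym_mat A \<and> (\<forall>v. v \<bullet> (A *v v) \<ge> 0)"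

definition spectral_norm :: "real ^ 't ^ 't \<Rightarrow> real" where
  "spectral_norm A = onorm ((*v) A)"

definition poly_smult_mat :: "'v mpoly \<Rightarrow> real ^ 't ^ 't \<Rightarrow> 'v mpoly ^ 't ^ 't" where
  "poly_smult_mat p A = map_matrix (\<lambda>a. p * Const a) A"

definition eval_mat :: "'v::finite mpoly ^ 't ^ 't \<Rightarrow> real ^ 'v \<Rightarrow> real ^ 't ^ 't" where
  "eval_mat G x = map_matrix (\<lambda>p. eval_poly p x) G"

definition coeff_mat :: "'v mpoly ^ 't ^ 't \<Rightarrow> ('v \<Rightarrow>\<^sub>0 nat) \<Rightarrow> real ^ 't ^ 't" where
  "coeff_mat G \<alpha> = map_matrix (\<lambda>p. coeff p \<alpha>) G"

definition deg_mat :: "'v::finite mpoly ^ 't ^ 't \<Rightarrow> nat" where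
  "deg_mat G = Max {total_deg (G $ i $ j) | i j. True}"

definition pos_def_on :: "'v::finite mpoly ^ 't ^ 't \<Rightarrow> (real ^ 'v) set \<Rightarrow> bool" where
  "pos_def_on G K \<longleftrightarrow> (\<forall>x\<in>K. pos_def (eval_mat G x))"

definition succeq_on ::
    "'v::finite mpoly ^ 't ^ 't \<Rightarrow> 'v mpoly ^ 't ^ 't \<Rightarrow> (real ^ 'v) set \<Rightarrow> bool" where
  "succeq_on G H K \<longleftrightarrow> (\<forall>x\<in>K. pos_semidef (eval_mat (G - H) x))"

definition C_const :: "'v::finite mpoly ^ 't ^ 't \<Rightarrow> real" where
  "C_const G = Max ((\<lambda>\<alpha>. spectral_norm (eval_mat (map_matrix (D_multi \<alpha>) G) 0) / fact (expo_deg \<alpha>))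
                      ` {\<alpha>. expo_deg \<alpha> \<le> deg_mat G})"

definition std_simplex :: "(real ^ 'm) set" where
  "std_simplex = {y. (\<forall>i. 0 \<le> y $ i) \<and> (\<Sum>i\<in>UNIV. y $ i) = 1}"

definition Yvec :: "'m mpoly ^ 'm" where
  "Yvec = (\<chi> i. pvar i)"

definition Ysum :: "'m::finite mpoly" where
  "Ysum = (\<Sum>i\<in>UNIV. pvar i)"

definition tilde :: "real ^ 'm ^ 'n \<Rightarrow> 'n::finite mpoly ^ 't ^ 't \<Rightarrow> 'm::finite mpoly ^ 't ^ 't" where
  "tilde B F = (\<Sum>\<alpha> | expo_deg \<alpha> \<le> deg_mat F.
     poly_smult_mat (mpow (Yvec v* transpose (map_matrix Const B)) \<alpha> * Ysum ^ (deg_mat F - expo_deg \<alpha>))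
       (coeff_mat F \<alpha>))"

definition homogenize :: "'m::finite mpoly ^ 't ^ 't \<Rightarrow> 'm mpoly ^ 't ^ 't" where
  "homogenize G = (\<Sum>\<beta> | expo_deg \<beta> \<le> deg_mat G.
     poly_smult_mat (mpow Yvec \<beta> * Ysum ^ (deg_mat G - expo_deg \<beta>)) (coeff_mat G \<beta>))"

end

theory Submission
  imports Defs
begin

text \<open>
  Substituting \<open>Y\<^sub>i \<mapsto> L\<^sub>i\<close> kills every \<open>R\<^sub>i\<close> and sends \<open>\<Sum>Y\<^sub>i\<close> to \<open>1\<close>, hence maps
  \<open>(\<Sum>Y\<^sub>i)^N * homogenize Fbar\<close> to \<open>F\<close>; the matrices sought are the coefficients of this product.
  Their quadratic forms at \<open>u\<close> are the coefficients of \<open>(\<Sum>Y\<^sub>i)^N * p\<close> with \<open>p = u\<^sup>T (homogenize Fbar) u\<close>,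
  so definiteness reduces to the scalar Polya theorem with the bound of Powers and Reznick.
  There, up to a positive factor, the coefficient at \<open>Y^\<beta>\<close> is \<open>p(\<beta>)\<close> with every monomial \<open>\<beta>^\<alpha>\<close>
  replaced by a product of falling factorials. The total error is controlled by comparing the
  multinomial theorem with its falling factorial analogue, the Chu--Vandermonde identity.
\<close>

section \<open>Coefficients of sums and products\<close>

definition hom_poly :: "nat \<Rightarrow> 'v::finite mpoly \<Rightarrow> bool" where
  "hom_poly d p \<longleftrightarrow> (\<forall>\<alpha>. coeff p \<alpha> \<noteq> 0 \<longrightarrow> expo_deg \<alpha> = d)"

definition expo_fact :: "('v::finite \<Rightarrow>\<^sub>0 nat) \<Rightarrow> real" where
  "expo_fact \<alpha> = (\<Prod>i\<in>UNIV. fact (Poly_Mapping.lookup \<alpha> i))"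

lemma coeff_simps [simp]:
  "coeff 0 \<alpha> = 0"
  "coeff (p + q) \<alpha> = coeff p \<alpha> + coeff q \<alpha>"
  by (simp_all add: coeff_def lookup_add)

lemma coeff_sum: "coeff (sum f A) \<alpha> = (\<Sum>x\<in>A. coeff (f x) \<alpha>)"
  by (induction A rule: infinite_finite_induct) auto

lemma coeff_single: "coeff (Poly_Mapping.single \<alpha> a) \<beta> = (if \<alpha> = \<beta> then a else 0)"
  by (simp add: coeff_def lookup_single when_def)

lemma in_keys_coeff: "\<alpha> \<in> Poly_Mapping.keys p \<longleftrightarrow> coeff p \<alpha> \<noteq> 0"
  by (simp add: coeff_def in_keys_iff)

lemma mpoly_eqI: "(\<And>\<alpha>. coeff p \<alpha> = coeff q \<alpha>) \<Longrightarrow> p = q"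
  by (simp add: coeff_def poly_mapping_eqI)

lemma mpoly_as_sum:
  assumes "finite A" "Poly_Mapping.keys p \<subseteq> A"
  shows "p = (\<Sum>\<alpha>\<in>A. Poly_Mapping.single \<alpha> (coeff p \<alpha>))"
proof (rule mpoly_eqI)
  fix \<beta>
  show "coeff p \<beta> = coeff (\<Sum>\<alpha>\<in>A. Poly_Mapping.single \<alpha> (coeff p \<alpha>)) \<beta>"
    using assms in_keys_coeff[of \<beta> p] by (auto simp: coeff_sum coeff_single)
qed

text \<open>Subtraction of exponents is truncated, so \<open>\<beta> - \<alpha> + \<alpha> = \<beta>\<close> says that \<open>\<alpha> \<le> \<beta>\<close> componentwise.\<close>

lemma coeff_mult_single:
  fixes q :: "'v mpoly"
  shows "coeff (q * Poly_Mapping.single \<alpha> a) \<beta> = (if \<beta> - \<alpha> + \<alpha> = \<beta> then coeff q (\<beta> - \<alpha>) * a else 0)"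
proof -
  \<comment> \<open>By cancellation at most one exponent \<gamma> can contribute to the coefficient
    at \<beta>, and none unless \<alpha> \<le> \<beta> componentwise.\<close>
  have eq: "\<gamma> + \<alpha> = \<beta> \<longleftrightarrow> \<gamma> = \<beta> - \<alpha> \<and> \<beta> - \<alpha> + \<alpha> = \<beta>" for \<gamma>
    by (metis add_diff_cancel_right')
  have "q * Poly_Mapping.single \<alpha> a =
      (\<Sum>\<gamma>\<in>Poly_Mapping.keys q. Poly_Mapping.single (\<gamma> + \<alpha>) (coeff q \<gamma> * a))"
    using arg_cong[OF mpoly_as_sum[OF finite_keys order_refl, of q], of "\<lambda>r. r * Poly_Mapping.single \<alpha> a"]
    by (simp only: sum_distrib_right mult_single)
  then have "coeff (q * Poly_Mapping.single \<alpha> a) \<beta> =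
      (\<Sum>\<gamma>\<in>Poly_Mapping.keys q. if \<gamma> = \<beta> - \<alpha> then (if \<beta> - \<alpha> + \<alpha> = \<beta> then coeff q \<gamma> * a else 0) else 0)"
    by (simp only: coeff_sum coeff_single) (rule sum.cong, rule refl, metis eq)
  also have "\<dots> = (if \<beta> - \<alpha> + \<alpha> = \<beta> then coeff q (\<beta> - \<alpha>) * a else 0)"
    using in_keys_coeff[of "\<beta> - \<alpha>" q] by (auto simp: sum.delta)
  finally show ?thesis .
qed

lemma coeff_mult:
  fixes p q :: "'v mpoly"
  assumes "finite A" "Poly_Mapping.keys p \<subseteq> A"
  shows "coeff (q * p) \<beta> = (\<Sum>\<alpha>\<in>A. if \<beta> - \<alpha> + \<alpha> = \<beta> then coeff q (\<beta> - \<alpha>) * coeff p \<alpha> else 0)"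
  using arg_cong[OF mpoly_as_sum[OF assms], of "\<lambda>r. coeff (q * r) \<beta>"]
  by (simp only: sum_distrib_left coeff_sum coeff_mult_single)

lemma coeff_Const_mult [simp]: "coeff (Const a * p) \<alpha> = a * coeff p \<alpha>"
  using coeff_mult_single[of p 0 a \<alpha>]
  by (simp add: Const_def mult.commute[of _ p] mult.commute[of a])

lemma Const_simps [simp]:
  "Const 0 = 0" "Const 1 = 1" "Const (a + b) = Const a + Const b" "Const (a * b) = Const a * Const b"
  by (simp_all add: Const_def single_add mult_single)

lemma expo_deg_add [simp]: "expo_deg (\<alpha> + \<beta>) = expo_deg \<alpha> + expo_deg \<beta>"
  by (simp add: expo_deg_def lookup_add sum.distrib)

lemma expo_deg_0 [simp]: "expo_deg 0 = 0"
  by (simp add: expo_deg_def)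

lemma expo_deg_single [simp]: "expo_deg (Poly_Mapping.single i k) = k"
  by (simp add: expo_deg_def lookup_single when_def)

lemma mpow_add: "mpow v (\<alpha> + \<beta>) = mpow v \<alpha> * mpow v \<beta>"
  by (simp add: mpow_def lookup_add power_add prod.distrib)

lemma mpow_0 [simp]: "mpow v 0 = 1"
  by (simp add: mpow_def)

lemma mpow_single [simp]: "mpow v (Poly_Mapping.single i k) = (v $ i) ^ k"
proof -
  have "mpow v (Poly_Mapping.single i k) = (\<Prod>j\<in>UNIV. if j = i then (v $ i) ^ k else 1)"
    unfolding mpow_def by (rule prod.cong) (auto simp: lookup_single)
  then show ?thesis by simp
qed

section \<open>Evaluation and substitution as ring homomorphisms\<close>

locale coeff_hom =
  fixes f :: "real \<Rightarrow> 'a::comm_ring_1"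
  assumes f_0: "f 0 = 0" and f_1: "f 1 = 1"
    and f_add: "f (a + b) = f a + f b" and f_mult: "f (a * b) = f a * f b"
begin

text \<open>A common form of \<open>eval_poly\<close> and \<open>subst_poly\<close>: the identity as
  \<open>f\<close> gives evaluation at a point, \<open>Const\<close> gives substitution of
  polynomials. The homomorphism laws are thus proved once for both.\<close>

definition insertion :: "'a ^ 'v::finite \<Rightarrow> 'v mpoly \<Rightarrow> 'a" where
  "insertion v p = (\<Sum>\<alpha>\<in>Poly_Mapping.keys p. f (coeff p \<alpha>) * mpow v \<alpha>)"

text \<open>Extra exponents have coefficient 0, and \<open>f 0 = 0\<close>. The freedom in
  \<open>A\<close> lets several polynomials be summed over one common index set.\<close>

lemma insertion_superset:
  assumes "finite A" "Poly_Mapping.keys p \<subseteq> A"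
  shows "insertion v p = (\<Sum>\<alpha>\<in>A. f (coeff p \<alpha>) * mpow v \<alpha>)"
  unfolding insertion_def
  by (rule sum.mono_neutral_left) (use assms in \<open>auto simp: in_keys_coeff f_0\<close>)

lemma insertion_add: "insertion v (p + q) = insertion v p + insertion v q"
proof -
  let ?A = "Poly_Mapping.keys p \<union> Poly_Mapping.keys q"
  have "finite ?A" "Poly_Mapping.keys p \<subseteq> ?A" "Poly_Mapping.keys q \<subseteq> ?A"
       "Poly_Mapping.keys (p + q) \<subseteq> ?A"
    by (auto simp: in_keys_coeff)
  then show ?thesis
    by (simp add: insertion_superset[of ?A] f_add distrib_right sum.distrib)
qed

lemma insertion_diff: "insertion v (p - q) = insertion v p - insertion v q"
  using insertion_add[of v "p - q" q] by simp

lemma insertion_0: "insertion v 0 = 0"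
  by (simp add: insertion_def)

lemma insertion_sum: "insertion v (sum g A) = (\<Sum>x\<in>A. insertion v (g x))"
  by (induction A rule: infinite_finite_induct) (auto simp: insertion_0 insertion_add)

lemma insertion_single: "insertion v (Poly_Mapping.single \<alpha> a) = f a * mpow v \<alpha>"
  by (subst insertion_superset[of "{\<alpha>}"]) (auto simp: coeff_single)

lemma insertion_mult: "insertion v (p * q) = insertion v p * insertion v q"
proof -
  let ?s = "\<lambda>p \<alpha>. Poly_Mapping.single \<alpha> (coeff p \<alpha>)"
  have "p * q = (\<Sum>\<alpha>\<in>Poly_Mapping.keys p. \<Sum>\<beta>\<in>Poly_Mapping.keys q. ?s p \<alpha> * ?s q \<beta>)"
    unfolding sum_product[symmetric]
    by (rule arg_cong2[of _ _ _ _ "(*)"]; rule mpoly_as_sum[OF finite_keys order_refl])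
  then show ?thesis
    by (simp add: insertion_sum mult_single insertion_single f_mult mpow_add)
       (simp add: insertion_def sum_product mult_ac)
qed

lemma insertion_1: "insertion v 1 = 1"
  using insertion_single[of v 0 1] by (simp add: f_1)

lemma insertion_Const: "insertion v (Const a) = f a"
  by (simp add: Const_def insertion_single)

lemma insertion_pvar: "insertion v (pvar i) = v $ i"
  by (simp add: pvar_def insertion_single f_1)

lemma insertion_power: "insertion v (p ^ k) = insertion v p ^ k"
  by (induction k) (auto simp: insertion_1 insertion_mult)

lemma insertion_prod: "insertion v (prod g A) = (\<Prod>x\<in>A. insertion v (g x))"
  by (induction A rule: infinite_finite_induct) (auto simp: insertion_1 insertion_mult)

lemma insertion_mpow: "insertion v (mpow w \<alpha>) = mpow (\<chi> i. insertion v (w $ i)) \<alpha>"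
  by (simp add: mpow_def insertion_prod insertion_power)

end

interpretation eval: coeff_hom "\<lambda>a. a"
  rewrites "coeff_hom.insertion (\<lambda>a. a) x p = eval_poly p x"
proof -
  show *: "coeff_hom (\<lambda>a::real. a)" by unfold_locales auto
  show "coeff_hom.insertion (\<lambda>a. a) x p = eval_poly p x"
    by (simp add: eval_poly_def coeff_hom.insertion_def[OF *])
qed

interpretation subst: coeff_hom Const
  rewrites "coeff_hom.insertion Const L p = subst_poly L p"
proof -
  show *: "coeff_hom Const" by unfold_locales auto
  show "coeff_hom.insertion Const L p = subst_poly L p"
    by (simp add: subst_poly_def coeff_hom.insertion_def[OF *])
qed

section \<open>Homogeneous polynomials\<close>

lemma hom_polyD: "hom_poly d p \<Longrightarrow> coeff p \<alpha> \<noteq> 0 \<Longrightarrow> expo_deg \<alpha> = d"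
  by (simp add: hom_poly_def)

lemma hom_poly_sum: "(\<And>x. x \<in> A \<Longrightarrow> hom_poly d (f x)) \<Longrightarrow> hom_poly d (sum f A)"
  unfolding hom_poly_def coeff_sum by (meson sum.not_neutral_contains_not_neutral)

lemma hom_poly_mult:
  assumes "hom_poly d p" "hom_poly e q"
  shows "hom_poly (d + e) (p * q)"
  unfolding hom_poly_def
proof (intro allI impI)
  fix \<beta> assume "coeff (p * q) \<beta> \<noteq> 0"
  then obtain \<alpha> where \<alpha>: "\<beta> - \<alpha> + \<alpha> = \<beta>" "coeff p (\<beta> - \<alpha>) * coeff q \<alpha> \<noteq> 0"
    unfolding coeff_mult[OF finite_keys order_refl]
    by (rule sum.not_neutral_contains_not_neutral) (meson that)
  then have "expo_deg (\<beta> - \<alpha>) = d" "expo_deg \<alpha> = e"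
    using assms by (auto dest: hom_polyD)
  then show "expo_deg \<beta> = d + e"
    using expo_deg_add[of "\<beta> - \<alpha>" \<alpha>] \<alpha>(1) by simp
qed

lemma hom_poly_single: "expo_deg \<alpha> = d \<Longrightarrow> hom_poly d (Poly_Mapping.single \<alpha> a)"
  by (simp add: hom_poly_def coeff_single)

lemma hom_poly_Const: "hom_poly 0 (Const a)"
  by (simp add: Const_def hom_poly_single)

lemma hom_poly_power: "hom_poly d p \<Longrightarrow> hom_poly (k * d) (p ^ k)"
proof (induction k)
  case 0
  then show ?case using hom_poly_Const[of 1] by simp
next
  case (Suc k)
  then show ?case using hom_poly_mult[of d p "k * d" "p ^ k"] by simp
qed

lemma hom_poly_prod:
  "(\<And>x. x \<in> A \<Longrightarrow> hom_poly (e x) (f x)) \<Longrightarrow> hom_poly (sum e A) (prod f A)"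
proof (induction A rule: infinite_finite_induct)
  case (insert x A)
  then show ?case using hom_poly_mult[of "e x" "f x"] by simp
qed (use hom_poly_Const[of 1] in auto)

lemma hom_poly_pvar: "hom_poly 1 (pvar i)"
  by (simp add: pvar_def hom_poly_single)

lemma hom_poly_mpow:
  assumes "\<And>i. hom_poly 1 (v $ i)"
  shows "hom_poly (expo_deg \<alpha>) (mpow v \<alpha>)"
  unfolding mpow_def expo_deg_def
  by (rule hom_poly_prod) (use hom_poly_power[OF assms] in simp)

lemma hom_poly_Ysum: "hom_poly 1 Ysum"
  unfolding Ysum_def by (intro hom_poly_sum hom_poly_pvar)

lemma mpow_scaleR: "mpow (r *\<^sub>R x) \<alpha> = r ^ expo_deg \<alpha> * mpow x \<alpha>" for x :: "real ^ 'v::finite"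
  by (simp add: mpow_def expo_deg_def power_mult_distrib prod.distrib power_sum)

lemma eval_poly_scaleR:
  assumes "hom_poly d p"
  shows "eval_poly p (r *\<^sub>R x) = r ^ d * eval_poly p x"
  unfolding eval_poly_def sum_distrib_left
  by (rule sum.cong) (use assms in \<open>auto simp: mpow_scaleR in_keys_coeff dest: hom_polyD\<close>)

section \<open>Factorials of exponents and the multinomial theorem\<close>

lemma expo_fact_pos: "expo_fact \<alpha> > 0"
  by (simp add: expo_fact_def prod_pos)

lemma expo_fact_add_single:
  "expo_fact (\<alpha> + Poly_Mapping.single i 1) = real (Poly_Mapping.lookup \<alpha> i + 1) * expo_fact \<alpha>"
proof -
  have "expo_fact (\<alpha> + Poly_Mapping.single i 1) =
      (\<Prod>j\<in>UNIV. (if j = i then real (Poly_Mapping.lookup \<alpha> i + 1) else 1) * fact (Poly_Mapping.lookup \<alpha> j))"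
    unfolding expo_fact_def by (rule prod.cong) (auto simp: lookup_add lookup_single)
  then show ?thesis by (simp add: prod.distrib expo_fact_def)
qed

lemma coeff_mult_pvar:
  "coeff (p * pvar i) \<alpha> =
     (if Poly_Mapping.lookup \<alpha> i = 0 then 0 else coeff p (\<alpha> - Poly_Mapping.single i 1))"
proof -
  have "\<alpha> - Poly_Mapping.single i 1 + Poly_Mapping.single i 1 = \<alpha> \<longleftrightarrow> Poly_Mapping.lookup \<alpha> i \<noteq> 0"
    by (auto simp: poly_mapping_eq_iff fun_eq_iff lookup_add lookup_minus lookup_single when_def)
  then show ?thesis by (simp add: pvar_def coeff_mult_single)
qed

lemma Ysum_times: "p * Ysum = (\<Sum>i\<in>UNIV. p * pvar i)"
  by (simp add: Ysum_def sum_distrib_left)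

text \<open>The multinomial theorem, by induction on \<open>N\<close>. Splitting off one factor
  \<open>Ysum\<close> writes the coefficient as a sum over the variables i; the term for i is N! /
  \<alpha>! times \<alpha>_i, and the \<alpha>_i add up to N + 1.\<close>

lemma coeff_Ysum_power:
  fixes \<alpha> :: "'v::finite \<Rightarrow>\<^sub>0 nat"
  shows "coeff (Ysum ^ N) \<alpha> = (if expo_deg \<alpha> = N then fact N / expo_fact \<alpha> else 0)"
proof (induction N arbitrary: \<alpha>)
  case 0
  have "expo_deg \<alpha> = 0 \<longleftrightarrow> \<alpha> = 0"
    by (auto simp: expo_deg_def intro: poly_mapping_eqI)
  moreover have "expo_fact (0 :: 'v \<Rightarrow>\<^sub>0 nat) = 1"
    by (simp add: expo_fact_def)
  ultimately show ?case
    using coeff_single[of 0 1 \<alpha>] by auto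
next
  case (Suc N)
  have "coeff (Ysum ^ N * pvar i) \<alpha> =
      (if expo_deg \<alpha> = Suc N then fact N / expo_fact \<alpha> * real (Poly_Mapping.lookup \<alpha> i) else 0)" for i
  proof (cases "Poly_Mapping.lookup \<alpha> i = 0")
    case True
    then show ?thesis by (simp add: coeff_mult_pvar)
  next
    case False
    define \<gamma> where "\<gamma> = \<alpha> - Poly_Mapping.single i 1"
    have \<alpha>: "\<alpha> = \<gamma> + Poly_Mapping.single i 1"
      using False unfolding \<gamma>_def
      by (auto intro!: poly_mapping_eqI simp: lookup_add lookup_minus lookup_single when_def)
    then have deg: "expo_deg \<alpha> = Suc (expo_deg \<gamma>)" by simp
    have "coeff (Ysum ^ N * pvar i) \<alpha> = coeff (Ysum ^ N) \<gamma>"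
      using False by (simp add: coeff_mult_pvar \<gamma>_def)
    moreover have "expo_fact \<alpha> = real (Poly_Mapping.lookup \<alpha> i) * expo_fact \<gamma>"
      using expo_fact_add_single[of \<gamma> i] unfolding \<alpha> by (simp add: lookup_add)
    ultimately show ?thesis
      using False Suc.IH[of \<gamma>] deg by simp
  qed
  moreover have "coeff (Ysum ^ Suc N) \<alpha> = (\<Sum>i\<in>UNIV. coeff (Ysum ^ N * pvar i) \<alpha>)"
    by (simp only: power_Suc2 sum_distrib_left coeff_sum Ysum_times)
  moreover have "(\<Sum>i\<in>UNIV. real (Poly_Mapping.lookup \<alpha> i)) = real (expo_deg \<alpha>)"
    by (simp add: expo_deg_def)
  ultimately show ?case
    by (auto simp: sum_distrib_left[symmetric] sum_divide_distrib[symmetric] simp del: power_Suc)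
qed

section \<open>Polya's theorem for scalar polynomials with an explicit bound\<close>

lemma power_minus_falling_factorial:
  "real (N + d) * (real (N + d) ^ d - fact (N + d) / fact N) \<le> real d * (real d - 1) / 2 * real (N + d) ^ d"
proof -
  \<comment> \<open>With M = N + d, the quotient of factorials is M (M - 1) ... (M - k + 1). Taking
    M - k instead of M as the next factor costs at most k M^k, and 0 + 1 + ... + (k - 1) = k (k - 1)
    / 2. The first conjunct supplies the bound M^k in this estimate; the extra factor M on the left
    avoids the exponent k - 1.\<close>
  have *: "k \<le> d \<Longrightarrow> fact (N + d) / fact (N + d - k) \<le> real (N + d) ^ k \<and>
    real (N + d) * (real (N + d) ^ k - fact (N + d) / fact (N + d - k))
       \<le> real k * (real k - 1) / 2 * real (N + d) ^ k" for k
  proof (induction k)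
    case (Suc k)
    define M where "M = real (N + d)"
    define f where "f = fact (N + d) / (fact (N + d - k) :: real)"
    have f: "f \<le> M ^ k" "M * (M ^ k - f) \<le> real k * (real k - 1) / 2 * M ^ k"
      using Suc unfolding M_def f_def by auto
    have kM: "real k \<le> M" using Suc.prems by (simp add: M_def)
    have "fact (N + d - k) = real (N + d - k) * (fact (N + d - Suc k) :: real)"
      using fact_reduce[of "N + d - k", where 'a = real] Suc.prems by (simp del: of_nat_diff)
    moreover have "real (N + d - k) = M - real k" "M - real k > 0"
      using Suc.prems unfolding M_def by auto
    ultimately have f': "fact (N + d) / (fact (N + d - Suc k) :: real) = f * (M - real k)"
      by (simp add: f_def)
    have "f * (M - real k) \<le> M ^ k * M"
      using f(1) kM by (intro mult_mono) (auto simp: M_def)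
    moreover have "M * (M ^ Suc k - f * (M - real k)) = M * (M * (M ^ k - f)) + M * real k * f"
      by (simp add: algebra_simps)
    moreover have "M * (M * (M ^ k - f)) \<le> M * (real k * (real k - 1) / 2 * M ^ k)"
      by (rule mult_left_mono[OF f(2)]) (simp add: M_def)
    moreover have "M * real k * f \<le> M * real k * M ^ k"
      by (rule mult_left_mono[OF f(1)]) (simp add: M_def)
    ultimately show ?case
      unfolding f' M_def[symmetric] by (simp add: field_simps)
  qed auto
  show ?thesis using *[of d] by simp
qed

text \<open>By \<open>bound\<close> the coefficients of \<open>p\<close> are at most those of K
  times \<open>Ysum ^ d\<close>. Hence passing from powers to falling factorials lowers the value of
  \<open>p\<close> at \<beta> by at most K times the loss for \<open>Ysum ^ d\<close>, where both
  values are known in closed form.\<close>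

lemma polya_coeff_pos:
  fixes p :: "'v::finite mpoly"
  assumes hom: "hom_poly d p"
    and bound: "\<And>\<alpha>. \<bar>coeff p \<alpha>\<bar> * expo_fact \<alpha> \<le> K * fact d"
    and lower: "\<And>x. x \<in> std_simplex \<Longrightarrow> l \<le> eval_poly p x"
    and N: "K * (real d * (real d - 1) / 2) < l * real (N + d)"
    and \<beta>: "expo_deg \<beta> = N + d"
  shows "coeff (Ysum ^ N * p) \<beta> > 0"
proof -
  define M where "M = real (N + d)"
  define A where "A = {\<alpha> :: 'v \<Rightarrow>\<^sub>0 nat. expo_deg \<alpha> = d}"
  define x where "x = (\<chi> i. real (Poly_Mapping.lookup \<beta> i))"
  \<comment> \<open>The product of the falling factorials \<beta>_i (\<beta>_i - 1) ... (\<beta>_i -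
    \<alpha>_i + 1). It vanishes when some \<alpha>_i exceeds \<beta>_i, hence the default
    0.\<close>
  define w where "w \<alpha> = (if \<beta> - \<alpha> + \<alpha> = \<beta> then expo_fact \<beta> / expo_fact (\<beta> - \<alpha>) else 0)" for \<alpha>
  have fin: "finite A"
    by (rule finite_subset[OF _ finite_expo_deg_le[of d]]) (auto simp: A_def)
  have keys: "Poly_Mapping.keys q \<subseteq> A" if "hom_poly d q" for q :: "'v mpoly"
    using that by (auto simp: A_def in_keys_coeff dest: hom_polyD)
  have K: "K \<ge> 0"
  proof -
    have "0 \<le> \<bar>coeff p 0\<bar> * expo_fact (0 :: 'v \<Rightarrow>\<^sub>0 nat)"
      using expo_fact_pos[of "0 :: 'v \<Rightarrow>\<^sub>0 nat"] by simp
    also have "\<dots> \<le> K * fact d" by (rule bound)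
    finally show ?thesis
      using fact_gt_zero[of d, where 'a = real] by (auto simp: zero_le_mult_iff)
  qed
  \<comment> \<open>For \<open>N + d = 0\<close> both sides of the strict inequality assumed on
    \<open>N\<close> would be 0.\<close>
  have M: "M > 0"
  proof (cases "N + d = 0")
    case True
    then show ?thesis using N by simp
  qed (simp add: M_def del: of_nat_add)
  have sum_x: "(\<Sum>i\<in>UNIV. x $ i) = M"
    using \<beta> by (simp add: x_def M_def expo_deg_def flip: of_nat_sum)
  have homY: "hom_poly d (Ysum ^ d :: 'v mpoly)"
    using hom_poly_power[OF hom_poly_Ysum, of d] by simp
  have coeffY: "coeff (Ysum ^ d) \<alpha> = fact d / expo_fact \<alpha>" if "\<alpha> \<in> A" for \<alpha>
    using that by (simp add: coeff_Ysum_power A_def)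
  \<comment> \<open>The factor \<open>Ysum ^ N\<close> contributes N! / (\<beta> - \<alpha>)!;
    pulling out N! / \<beta>! leaves exactly \<open>w \<alpha>\<close>.\<close>
  have prod: "coeff (Ysum ^ N * q) \<beta> = fact N / expo_fact \<beta> * (\<Sum>\<alpha>\<in>A. coeff q \<alpha> * w \<alpha>)"
    if "hom_poly d q" for q
  proof -
    have deg: "expo_deg (\<beta> - \<alpha>) = N" if "\<alpha> \<in> A" "\<beta> - \<alpha> + \<alpha> = \<beta>" for \<alpha>
      using that \<beta> expo_deg_add[of "\<beta> - \<alpha>" \<alpha>] by (simp add: A_def)
    show ?thesis
      unfolding coeff_mult[OF fin keys[OF that]] sum_distrib_left
      by (rule sum.cong)
         (use deg expo_fact_pos[of \<beta>] in \<open>auto simp: w_def coeff_Ysum_power\<close>)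
  qed
  have evl: "eval_poly q x = (\<Sum>\<alpha>\<in>A. coeff q \<alpha> * mpow x \<alpha>)" if "hom_poly d q" for q
    by (rule eval.insertion_superset[OF fin keys[OF that]])
  \<comment> \<open>Coordinate by coordinate, a falling factorial of k factors starting at n is at
    most n^k.\<close>
  have w_le: "w \<alpha> \<le> mpow x \<alpha>" for \<alpha>
  proof (cases "\<beta> - \<alpha> + \<alpha> = \<beta>")
    case True
    have le: "Poly_Mapping.lookup \<alpha> i \<le> Poly_Mapping.lookup \<beta> i" for i
      using arg_cong[OF True, of "\<lambda>g. Poly_Mapping.lookup g i"]
      by (simp add: lookup_add lookup_minus)
    have "w \<alpha> = (\<Prod>i\<in>UNIV. fact (Poly_Mapping.lookup \<beta> i) /
        fact (Poly_Mapping.lookup \<beta> i - Poly_Mapping.lookup \<alpha> i))"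
      using True by (simp add: w_def expo_fact_def lookup_minus prod_dividef)
    also have "\<dots> \<le> (\<Prod>i\<in>UNIV. real (Poly_Mapping.lookup \<beta> i) ^ Poly_Mapping.lookup \<alpha> i)"
    proof (intro prod_mono conjI)
      fix i
      let ?n = "Poly_Mapping.lookup \<beta> i" and ?k = "Poly_Mapping.lookup \<alpha> i"
      have "fact ?n / (fact (?n - ?k) :: real) = real (fact ?n div fact (?n - ?k))"
        by (simp add: real_of_nat_div fact_dvd)
      also have "\<dots> \<le> real (?n ^ ?k)"
        unfolding of_nat_le_iff using fact_div_fact_le_pow[OF le[of i]] .
      finally show "fact ?n / (fact (?n - ?k) :: real) \<le> real ?n ^ ?k" by simp
    qed simp
    also have "\<dots> = mpow x \<alpha>" by (simp add: mpow_def x_def)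
    finally show ?thesis .
  qed (simp add: w_def mpow_def x_def prod_nonneg)
  \<comment> \<open>The multinomial theorem at \<open>x\<close>, whose coordinates add up to
    \<open>M\<close>.\<close>
  have pow: "(\<Sum>\<alpha>\<in>A. fact d / expo_fact \<alpha> * mpow x \<alpha>) = M ^ d"
  proof -
    have "eval_poly (Ysum ^ d) x = M ^ d"
      using sum_x by (simp add: eval.insertion_power Ysum_def eval.insertion_sum eval.insertion_pvar)
    then show ?thesis using evl[OF homY] by (simp add: coeffY cong: sum.cong)
  qed
  text \<open>The Chu--Vandermonde identity, read off from \<open>Ysum ^ N * Ysum ^ d = Ysum ^ (N + d)\<close>.\<close>
  have vandermonde: "(\<Sum>\<alpha>\<in>A. fact d / expo_fact \<alpha> * w \<alpha>) = fact (N + d) / fact N"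
  proof -
    have "fact (N + d) / expo_fact \<beta> = coeff (Ysum ^ N * Ysum ^ d) \<beta>"
      using \<beta> by (simp add: coeff_Ysum_power flip: power_add)
    also have "\<dots> = fact N / expo_fact \<beta> * (\<Sum>\<alpha>\<in>A. fact d / expo_fact \<alpha> * w \<alpha>)"
      unfolding prod[OF homY] by (simp add: coeffY cong: sum.cong)
    finally show ?thesis using expo_fact_pos[of \<beta>] by (simp add: field_simps)
  qed
  define S where "S = (\<Sum>\<alpha>\<in>A. coeff p \<alpha> * w \<alpha>)"
  have "eval_poly p x - S = (\<Sum>\<alpha>\<in>A. coeff p \<alpha> * (mpow x \<alpha> - w \<alpha>))"
    unfolding S_def evl[OF hom] by (simp add: sum_subtractf algebra_simps)
  \<comment> \<open>The coefficients may be replaced by upper bounds because every difference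
    \<open>mpow x \<alpha> - w \<alpha>\<close> is nonnegative.\<close>
  also have "\<dots> \<le> (\<Sum>\<alpha>\<in>A. K * (fact d / expo_fact \<alpha>) * (mpow x \<alpha> - w \<alpha>))"
  proof (intro sum_mono mult_right_mono)
    fix \<alpha>
    have "coeff p \<alpha> * expo_fact \<alpha> \<le> \<bar>coeff p \<alpha>\<bar> * expo_fact \<alpha>"
      using expo_fact_pos[of \<alpha>] by (intro mult_right_mono) auto
    then have "coeff p \<alpha> * expo_fact \<alpha> \<le> K * fact d" using bound[of \<alpha>] by simp
    then show "coeff p \<alpha> \<le> K * (fact d / expo_fact \<alpha>)"
      using expo_fact_pos[of \<alpha>] by (simp add: pos_le_divide_eq)
    show "0 \<le> mpow x \<alpha> - w \<alpha>" using w_le by simp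
  qed
  also have "\<dots> = K * ((\<Sum>\<alpha>\<in>A. fact d / expo_fact \<alpha> * mpow x \<alpha>) - (\<Sum>\<alpha>\<in>A. fact d / expo_fact \<alpha> * w \<alpha>))"
    by (simp add: sum_distrib_left right_diff_distrib mult.assoc flip: sum_subtractf)
  also have "\<dots> = K * (M ^ d - fact (N + d) / fact N)"
    by (simp only: pow vandermonde)
  finally have diff: "eval_poly p x - S \<le> K * (M ^ d - fact (N + d) / fact N)" .
  \<comment> \<open>Homogeneity carries the lower bound from the simplex point x / M to x.\<close>
  have "l * M ^ d \<le> eval_poly p x"
  proof -
    have "(1 / M) *\<^sub>R x \<in> std_simplex"
      using M sum_x by (simp add: std_simplex_def x_def flip: sum_divide_distrib)
    then have "l \<le> (1 / M) ^ d * eval_poly p x"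
      using lower eval_poly_scaleR[OF hom] by metis
    then show ?thesis using M by (simp add: power_one_over field_simps)
  qed
  with diff have "l * M ^ d - K * (M ^ d - fact (N + d) / fact N) \<le> S" by simp
  \<comment> \<open>After multiplication by M the loss is controlled by
    \<open>power_minus_falling_factorial\<close>, and the assumption on \<open>N\<close> makes the
    left side positive.\<close>
  then have "M * (l * M ^ d - K * (M ^ d - fact (N + d) / fact N)) \<le> M * S"
    using M by (intro mult_left_mono) auto
  moreover have "K * (M * (M ^ d - fact (N + d) / fact N)) \<le> K * (real d * (real d - 1) / 2 * M ^ d)"
    unfolding M_def by (rule mult_left_mono[OF power_minus_falling_factorial K])
  moreover have "K * (real d * (real d - 1) / 2) * M ^ d < l * M * M ^ d"
    using N M by (intro mult_strict_right_mono) (auto simp: M_def)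
  moreover have "M * (l * M ^ d - K * (M ^ d - fact (N + d) / fact N)) =
      l * M * M ^ d - K * (M * (M ^ d - fact (N + d) / fact N))"
    by (simp add: algebra_simps)
  ultimately have "M * S > 0" by (simp only: mult.assoc)
  then have "S > 0" using M by (simp add: zero_less_mult_iff)
  then show ?thesis
    unfolding prod[OF hom] S_def using expo_fact_pos[of \<beta>] by simp
qed

section \<open>Coefficients from derivatives at the origin\<close>

lemma coeff_partial_power:
  "coeff ((partial i ^^ k) p) \<beta> =
     fact (Poly_Mapping.lookup \<beta> i + k) / fact (Poly_Mapping.lookup \<beta> i) * coeff p (\<beta> + Poly_Mapping.single i k)"
proof (induction k arbitrary: \<beta>)
  case (Suc k)
  have "Poly_Mapping.single i 1 + Poly_Mapping.single i k = Poly_Mapping.single i (Suc k)"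
    by (simp flip: single_add)
  then show ?case
    by (simp add: coeff_partial Suc.IH lookup_add add.assoc)
qed simp

text \<open>\<open>D_multi\<close> folds over all variables; an arbitrary finite set
  \<open>S\<close> allows induction. Differentiating in a new variable i shifts \<beta> only in
  coordinate i, so the factors for the other variables are unaffected.\<close>

lemma coeff_fold_partial:
  fixes \<alpha> :: "'v \<Rightarrow>\<^sub>0 nat"
  assumes "finite S"
  shows "coeff (Finite_Set.fold (\<lambda>i. partial i ^^ Poly_Mapping.lookup \<alpha> i) p S) \<beta> =
     (\<Prod>i\<in>S. fact (Poly_Mapping.lookup \<beta> i + Poly_Mapping.lookup \<alpha> i) / fact (Poly_Mapping.lookup \<beta> i)) *
     coeff p (\<beta> + (\<Sum>i\<in>S. Poly_Mapping.single i (Poly_Mapping.lookup \<alpha> i)))"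
  using assms
proof (induction S arbitrary: \<beta> rule: finite_induct)
  case (insert i S)
  interpret comp_fun_commute "\<lambda>i. partial i ^^ Poly_Mapping.lookup \<alpha> i"
    by (rule comp_fun_commute_partial)
  let ?b = "\<beta> + Poly_Mapping.single i (Poly_Mapping.lookup \<alpha> i)"
  have eq: "Poly_Mapping.lookup ?b j = Poly_Mapping.lookup \<beta> j" if "j \<in> S" for j
    using that insert.hyps by (auto simp: lookup_add lookup_single when_def)
  show ?case
    using insert.hyps
    by (simp add: fold_insert coeff_partial_power
        insert.IH eq add.assoc cong: prod.cong)
qed simp

lemma coeff_D_multi_0: "coeff (D_multi \<alpha> p) 0 = expo_fact \<alpha> * coeff p \<alpha>"
proof -
  have "(\<Sum>i\<in>UNIV. Poly_Mapping.single i (Poly_Mapping.lookup \<alpha> i)) = \<alpha>"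
    by (rule poly_mapping_eqI) (simp add: lookup_sum lookup_single when_def)
  then show ?thesis
    by (simp add: D_multi_def coeff_fold_partial expo_fact_def)
qed

lemma eval_poly_0:
  fixes p :: "'v::finite mpoly"
  shows "eval_poly p 0 = coeff p 0"
proof -
  \<comment> \<open>As \<open>0 ^ 0 = 1\<close>, only the empty monomial survives at the
    origin.\<close>
  have "mpow (0 :: real ^ 'v) \<alpha> = (if \<alpha> = 0 then 1 else 0)" for \<alpha> :: "'v \<Rightarrow>\<^sub>0 nat"
    by (auto simp: mpow_def poly_mapping_eq_iff fun_eq_iff)
  then show ?thesis
    by (simp add: eval_poly_def if_distrib[of "(*) _"] in_keys_coeff cong: if_cong)
qed

section \<open>Polynomial matrices and the constant \<open>C_const\<close>\<close>

lemma sum_nth_matrix: "(\<Sum>x\<in>A. (M x :: 'a::comm_monoid_add ^ 'b ^ 'c)) $ i $ j = (\<Sum>x\<in>A. M x $ i $ j)"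
  by (induction A rule: infinite_finite_induct) auto

lemma poly_smult_mat_nth [simp]: "poly_smult_mat p A $ i $ j = p * Const (A $ i $ j)"
  by (simp add: poly_smult_mat_def map_matrix_def)

lemma coeff_mat_nth [simp]: "coeff_mat G \<alpha> $ i $ j = coeff (G $ i $ j) \<alpha>"
  by (simp add: coeff_mat_def map_matrix_def)

lemma eval_mat_nth [simp]: "eval_mat G x $ i $ j = eval_poly (G $ i $ j) x"
  by (simp add: eval_mat_def map_matrix_def)

lemma eval_mat_D_multi_0: "eval_mat (map_matrix (D_multi \<alpha>) G) 0 = expo_fact \<alpha> *\<^sub>R coeff_mat G \<alpha>"
  by (simp add: vec_eq_iff eval_poly_0 coeff_D_multi_0 map_matrix_def)

lemma expo_deg_le_deg_mat:
  fixes G :: "'v::finite mpoly ^ 't::finite ^ 't"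
  assumes "coeff (G $ i $ j) \<alpha> \<noteq> 0"
  shows "expo_deg \<alpha> \<le> deg_mat G"
proof -
  have "expo_deg \<alpha> \<le> total_deg (G $ i $ j)"
    using assms unfolding total_deg_def by (intro Max_ge) (auto simp: in_keys_coeff)
  also have "{total_deg (G $ i $ j) | i j. True} = (\<lambda>(i, j). total_deg (G $ i $ j)) ` UNIV"
    by auto
  then have "total_deg (G $ i $ j) \<le> deg_mat G"
    unfolding deg_mat_def by (intro Max_ge) auto
  finally show ?thesis .
qed

text \<open>By \<open>eval_mat_D_multi_0\<close> the quotients in \<open>C_const\<close> are
  \<alpha>! / |\<alpha>|! times the spectral norm of the coefficient. Coefficients beyond
  \<open>deg_mat G\<close> vanish and the constant is nonnegative, so the estimate extends to all
  exponents and can be used for a homogenization without computing its degree.\<close>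

lemma spectral_norm_coeff_le:
  fixes G :: "'v::finite mpoly ^ 't::finite ^ 't"
  shows "expo_fact \<alpha> * spectral_norm (coeff_mat G \<alpha>) \<le> C_const G * fact (expo_deg \<alpha>)"
proof -
  have fin: "finite ((\<lambda>\<alpha>. spectral_norm (eval_mat (map_matrix (D_multi \<alpha>) G) 0) / fact (expo_deg \<alpha>))
      ` {\<alpha>. expo_deg \<alpha> \<le> deg_mat G})"
    by (intro finite_imageI finite_expo_deg_le)
  have bl: "bounded_linear ((*v) A)" for A :: "real ^ 't ^ 't"
    by (simp add: matrix_vector_mul_bounded_linear)
  have norm: "spectral_norm (eval_mat (map_matrix (D_multi \<alpha>) G) 0) =
      expo_fact \<alpha> * spectral_norm (coeff_mat G \<alpha>)" for \<alpha>
    using onorm_scaleR[OF bl, of "expo_fact \<alpha>" "coeff_mat G \<alpha>"] expo_fact_pos[of \<alpha>]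
    by (simp add: eval_mat_D_multi_0 spectral_norm_def scaleR_matrix_vector_assoc)
  have le: "expo_fact \<alpha> * spectral_norm (coeff_mat G \<alpha>) \<le> C_const G * fact (expo_deg \<alpha>)"
    if "expo_deg \<alpha> \<le> deg_mat G" for \<alpha>
    using Max_ge[OF fin, of "expo_fact \<alpha> * spectral_norm (coeff_mat G \<alpha>) / fact (expo_deg \<alpha>)"] that
    by (auto simp: C_const_def norm field_simps)
  have C: "0 \<le> C_const G"
  proof -
    have "0 \<le> expo_fact (0 :: 'v \<Rightarrow>\<^sub>0 nat) * spectral_norm (coeff_mat G 0)"
      using onorm_pos_le[OF bl, of "coeff_mat G 0"] expo_fact_pos[of "0 :: 'v \<Rightarrow>\<^sub>0 nat"]
      by (simp add: spectral_norm_def)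
    also have "\<dots> \<le> C_const G" using le[of 0] by simp
    finally show ?thesis .
  qed
  show ?thesis
  proof (cases "expo_deg \<alpha> \<le> deg_mat G")
    case False
    then have "coeff_mat G \<alpha> = 0"
      using expo_deg_le_deg_mat[of G _ _ \<alpha>] by (auto simp: vec_eq_iff)
    then have "spectral_norm (coeff_mat G \<alpha>) = 0"
      using onorm_zero[where 'a = "real ^ 't" and 'b = "real ^ 't"]
      by (simp add: spectral_norm_def matrix_vector_mult_0[abs_def])
    then show ?thesis using C by simp
  qed (rule le)
qed

section \<open>Quadratic forms as scalar polynomials\<close>

definition quad_form_poly :: "real ^ 't \<Rightarrow> 'v mpoly ^ 't ^ 't \<Rightarrow> 'v mpoly" where
  "quad_form_poly u G = (\<Sum>i\<in>UNIV. \<Sum>j\<in>UNIV. Const (u $ i * u $ j) * G $ i $ j)"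

lemma quadratic_form_sum: "u \<bullet> (A *v u) = (\<Sum>i\<in>UNIV. \<Sum>j\<in>UNIV. u $ i * u $ j * A $ i $ j)"
  for A :: "real ^ 't::finite ^ 't"
  by (simp add: inner_vec_def matrix_vector_mult_def sum_distrib_left mult_ac)

text \<open>Together with \<open>eval_quad_form_poly\<close> and \<open>mult_quad_form_poly\<close>:
  coefficients, values and multiplication by a scalar polynomial all commute with the quadratic form
  at a fixed \<open>u\<close>. Definiteness of matrix coefficients thus becomes positivity of scalar
  ones for each nonzero \<open>u\<close>.\<close>

lemma coeff_quad_form_poly:
  "coeff (quad_form_poly u G) \<alpha> = u \<bullet> (coeff_mat G \<alpha> *v u)" for u :: "real ^ 't::finite"
  by (simp add: quad_form_poly_def coeff_sum quadratic_form_sum del: Const_simps)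

lemma eval_quad_form_poly:
  "eval_poly (quad_form_poly u G) x = u \<bullet> (eval_mat G x *v u)" for u :: "real ^ 't::finite"
  by (simp add: quad_form_poly_def quadratic_form_sum eval.insertion_sum eval.insertion_mult eval.insertion_Const)

lemma mult_quad_form_poly:
  "q * quad_form_poly u G = quad_form_poly u (map_matrix ((*) q) G)"
  by (simp add: quad_form_poly_def sum_distrib_left map_matrix_def mult_ac)

lemma map_matrix_nth [simp]: "map_matrix f A $ i $ j = f (A $ i $ j)"
  by (simp add: map_matrix_def)

section \<open>Substituting the linear forms into \<open>tilde\<close> and
  \<open>homogenize\<close>\<close>

lemma mpow_Yvec: "mpow Yvec \<alpha> = Poly_Mapping.single \<alpha> 1"
proof -
  have pow: "pvar i ^ k = Poly_Mapping.single (Poly_Mapping.single i k) (1::real)" for i :: 'a and k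
    by (induction k) (simp_all add: pvar_def mult_single flip: single_add)
  have prod: "(\<Prod>i\<in>A. Poly_Mapping.single (g i) (1::real)) = Poly_Mapping.single (sum g A) 1"
    for g :: "'a \<Rightarrow> ('a \<Rightarrow>\<^sub>0 nat)" and A
    by (induction A rule: infinite_finite_induct) (simp_all add: mult_single)
  have "(\<Sum>i\<in>UNIV. Poly_Mapping.single i (Poly_Mapping.lookup \<alpha> i)) = \<alpha>"
    by (rule poly_mapping_eqI) (simp add: lookup_sum lookup_single when_def)
  then show ?thesis
    by (simp add: mpow_def Yvec_def pow prod)
qed

lemma subst_poly_Yvec: "subst_poly Yvec p = p"
proof -
  have "Const a * Poly_Mapping.single \<alpha> 1 = Poly_Mapping.single \<alpha> a" for a and \<alpha> :: "'a \<Rightarrow>\<^sub>0 nat"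
    by (simp add: Const_def mult_single)
  then show ?thesis
    using mpoly_as_sum[OF finite_keys order_refl, of p] by (simp add: subst_poly_def mpow_Yvec)
qed

lemma subst_poly_Ysum:
  assumes "(\<Sum>i\<in>UNIV. L $ i) = 1"
  shows "subst_poly L Ysum = 1"
  using assms by (simp add: Ysum_def subst.insertion_sum subst.insertion_pvar)

text \<open>Every entry is expanded over the exponent range used in \<open>tilde\<close> and
  \<open>homogenize\<close>, so that the images can be compared term by term.\<close>

lemma subst_poly_deg_mat:
  fixes G :: "'v::finite mpoly ^ 't::finite ^ 't"
  shows "subst_poly L (G $ i $ j) = (\<Sum>\<alpha> | expo_deg \<alpha> \<le> deg_mat G. mpow L \<alpha> * Const (coeff (G $ i $ j) \<alpha>))"
proof -
  have "Poly_Mapping.keys (G $ i $ j) \<subseteq> {\<alpha>. expo_deg \<alpha> \<le> deg_mat G}"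
    using expo_deg_le_deg_mat by (auto simp: in_keys_coeff)
  then show ?thesis
    by (subst subst.insertion_superset[OF finite_expo_deg_le]) (simp_all add: mult.commute)
qed

text \<open>The powers of \<open>Ysum\<close> that pad each term to full degree become 1.\<close>

lemma subst_poly_homogenize:
  fixes G :: "'v::finite mpoly ^ 't::finite ^ 't"
  assumes "(\<Sum>i\<in>UNIV. L $ i) = 1"
  shows "subst_poly L (homogenize G $ i $ j) = subst_poly L (G $ i $ j)"
proof -
  have "(\<chi> i. subst_poly L (Yvec $ i)) = L"
    by (simp add: vec_eq_iff Yvec_def subst.insertion_pvar)
  then show ?thesis
    by (simp add: homogenize_def sum_nth_matrix subst.insertion_sum subst.insertion_mult
        subst.insertion_mpow subst.insertion_power subst.insertion_Const subst_poly_Ysum[OF assms]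
        subst_poly_deg_mat)
qed

lemma subst_poly_tilde:
  fixes F :: "'n::finite mpoly ^ 't::finite ^ 't" and B :: "real ^ 'm::finite ^ 'n"
  assumes sum: "(\<Sum>i\<in>UNIV. L $ i) = 1"
    and B: "\<And>i. pvar i = (\<Sum>j\<in>UNIV. Const (B $ i $ j) * L $ j)"
  shows "subst_poly L (tilde B F $ i $ j) = F $ i $ j"
proof -
  \<comment> \<open>\<open>Yvec\<close> occurs in two sets of variables: Y on the left, the
    variables X of \<open>F\<close> on the right. By the choice of \<open>B\<close>, Y B^T is sent
    to X, so substituting in \<open>tilde B F\<close> amounts to substituting X for itself in
    \<open>F\<close>.\<close>
  have "(\<chi> k. subst_poly L ((Yvec v* transpose (map_matrix Const B)) $ k)) = Yvec"
    by (simp add: vec_eq_iff Yvec_def B vector_matrix_mult_def transpose_def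
        subst.insertion_sum subst.insertion_mult subst.insertion_Const subst.insertion_pvar mult.commute)
  then have "subst_poly L (tilde B F $ i $ j) = subst_poly Yvec (F $ i $ j)"
    by (simp add: tilde_def sum_nth_matrix subst.insertion_sum subst.insertion_mult
        subst.insertion_mpow subst.insertion_power subst.insertion_Const subst_poly_Ysum[OF sum]
        subst_poly_deg_mat)
  then show ?thesis by (simp add: subst_poly_Yvec)
qed

lemma hom_poly_homogenize:
  fixes G :: "'v::finite mpoly ^ 't::finite ^ 't"
  shows "hom_poly (deg_mat G) (homogenize G $ i $ j)"
  unfolding homogenize_def sum_nth_matrix poly_smult_mat_nth
proof (rule hom_poly_sum)
  fix \<beta> :: "'v \<Rightarrow>\<^sub>0 nat" assume \<beta>: "\<beta> \<in> {\<beta>. expo_deg \<beta> \<le> deg_mat G}"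
  have "hom_poly (expo_deg \<beta>) (mpow Yvec \<beta> :: 'v mpoly)"
    by (rule hom_poly_mpow) (simp add: Yvec_def hom_poly_pvar[simplified])
  moreover have "hom_poly (deg_mat G - expo_deg \<beta>) (Ysum ^ (deg_mat G - expo_deg \<beta>) :: 'v mpoly)"
    using hom_poly_power[OF hom_poly_Ysum] by simp
  ultimately have "hom_poly (expo_deg \<beta> + (deg_mat G - expo_deg \<beta>) + 0)
      (mpow Yvec \<beta> * Ysum ^ (deg_mat G - expo_deg \<beta>) * Const (coeff_mat G \<beta> $ i $ j))"
    by (intro hom_poly_mult hom_poly_Const)
  then show "hom_poly (deg_mat G) (mpow Yvec \<beta> * Ysum ^ (deg_mat G - expo_deg \<beta>) * Const (coeff_mat G \<beta> $ i $ j))"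
    using \<beta> by simp
qed

section \<open>Symmetry and Polya's theorem for matrices\<close>

lemma sym_mat_nth: "sym_mat A \<longleftrightarrow> (\<forall>i j. A $ i $ j = A $ j $ i)"
  by (auto simp: sym_mat_def transpose_def vec_eq_iff)

lemma sym_mat_tilde: "sym_mat F \<Longrightarrow> sym_mat (tilde B F)"
  by (simp add: sym_mat_nth tilde_def sum_nth_matrix)

lemma sym_mat_homogenize: "sym_mat G \<Longrightarrow> sym_mat (homogenize G)"
  by (simp add: sym_mat_nth homogenize_def sum_nth_matrix)

lemma succeq_on_mat_Const:
  fixes G :: "'v::finite mpoly ^ 't::finite ^ 't"
  assumes "succeq_on G (mat (Const l)) S" "x \<in> S"
  shows "l * (u \<bullet> u) \<le> u \<bullet> (eval_mat G x *v u)"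
proof -
  have "eval_mat (G - mat (Const l)) x = eval_mat G x - l *\<^sub>R mat 1"
    using eval.insertion_0[of x]
    by (auto simp: vec_eq_iff mat_def eval.insertion_diff eval.insertion_Const)
  then have "0 \<le> u \<bullet> ((eval_mat G x - l *\<^sub>R mat 1) *v u)"
    using assms unfolding succeq_on_def pos_semidef_def by metis
  then show ?thesis
    by (simp add: matrix_vector_mult_diff_rdistrib inner_diff_right flip: scaleR_matrix_vector_assoc)
qed

lemma C_const_nonneg: "0 \<le> C_const G"
  for G :: "'v::finite mpoly ^ 't::finite ^ 't"
proof -
  have "0 \<le> spectral_norm (coeff_mat G 0)"
    unfolding spectral_norm_def by (rule onorm_pos_le) (simp add: matrix_vector_mul_bounded_linear)
  then have "0 \<le> expo_fact (0 :: 'v \<Rightarrow>\<^sub>0 nat) * spectral_norm (coeff_mat G 0)"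
    using expo_fact_pos[of "0 :: 'v \<Rightarrow>\<^sub>0 nat"] by simp
  also have "\<dots> \<le> C_const G"
    using spectral_norm_coeff_le[of 0 G] by simp
  finally show ?thesis .
qed

text \<open>Cauchy-Schwarz and the operator norm bound |u^T A u| by the spectral norm of A times
  \<open>u \<bullet> u\<close>; \<open>spectral_norm_coeff_le\<close> does the rest.\<close>

lemma coeff_quad_form_poly_le:
  fixes G :: "'v::finite mpoly ^ 't::finite ^ 't"
  shows "\<bar>coeff (quad_form_poly u G) \<alpha>\<bar> * expo_fact \<alpha> \<le> C_const G * (u \<bullet> u) * fact (expo_deg \<alpha>)"
proof -
  let ?A = "coeff_mat G \<alpha>"
  have "\<bar>u \<bullet> (?A *v u)\<bar> \<le> norm u * norm (?A *v u)"
    by (rule Cauchy_Schwarz_ineq2)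
  also have "\<dots> \<le> norm u * (spectral_norm ?A * norm u)"
    unfolding spectral_norm_def
    by (intro mult_left_mono onorm matrix_vector_mul_bounded_linear) simp
  finally have "\<bar>u \<bullet> (?A *v u)\<bar> * expo_fact \<alpha> \<le> norm u * (spectral_norm ?A * norm u) * expo_fact \<alpha>"
    using expo_fact_pos[of \<alpha>] by (intro mult_right_mono) auto
  also have "\<dots> = (u \<bullet> u) * (expo_fact \<alpha> * spectral_norm ?A)"
    by (simp add: power2_norm_eq_inner[symmetric] power2_eq_square)
  also have "\<dots> \<le> (u \<bullet> u) * (C_const G * fact (expo_deg \<alpha>))"
    by (intro mult_left_mono spectral_norm_coeff_le) simp
  finally show ?thesis
    by (simp add: coeff_quad_form_poly mult_ac)
qed

text \<open>For each nonzero \<open>u\<close>, \<open>polya_coeff_pos\<close> applies to u^T H u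
  with \<open>C_const H * (u \<bullet> u)\<close> as \<open>K\<close> and
  \<open>l * (u \<bullet> u)\<close> as lower bound. The factor \<open>u \<bullet> u\<close> cancels
  from the condition on \<open>N\<close>, so one \<open>N\<close> serves all
  \<open>u\<close>.\<close>

lemma polya_matrix:
  fixes H :: "'v::finite mpoly ^ 't::finite ^ 't"
  assumes hom: "\<And>i j. hom_poly d (H $ i $ j)"
    and sym: "sym_mat H"
    and l: "l > 0"
    and lower: "succeq_on H (mat (Const l)) std_simplex"
    and N: "real N > real d * (real d - 1) / 2 * (C_const H / l) - real d"
    and \<alpha>: "expo_deg \<alpha> = N + d"
  shows "pos_def (coeff_mat (map_matrix ((*) (Ysum ^ N)) H) \<alpha>)"
  unfolding pos_def_def
proof (intro conjI allI impI)
  show "sym_mat (coeff_mat (map_matrix ((*) (Ysum ^ N)) H) \<alpha>)"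
    using sym by (simp add: sym_mat_nth)
  fix u :: "real ^ 't" assume "u \<noteq> 0"
  then have u: "u \<bullet> u > 0" by simp
  have homq: "hom_poly d (quad_form_poly u H)"
    unfolding quad_form_poly_def
    by (intro hom_poly_sum) (use hom_poly_mult[OF hom_poly_Const hom] in \<open>simp del: Const_simps\<close>)
  have "C_const H * (real d * (real d - 1) / 2) < l * real (N + d)"
    using N l by (simp add: field_simps)
  then have "C_const H * (real d * (real d - 1) / 2) * (u \<bullet> u) < l * real (N + d) * (u \<bullet> u)"
    using u by (rule mult_strict_right_mono)
  then have N': "C_const H * (u \<bullet> u) * (real d * (real d - 1) / 2) < l * (u \<bullet> u) * real (N + d)"
    by (simp only: mult_ac)
  \<comment> \<open>At a nonzero coefficient homogeneity gives \<open>expo_deg \<beta> = d\<close>;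
    elsewhere the left side is 0 and the right side is nonnegative.\<close>
  have bound: "\<bar>coeff (quad_form_poly u H) \<beta>\<bar> * expo_fact \<beta> \<le> C_const H * (u \<bullet> u) * fact d" for \<beta>
  proof (cases "coeff (quad_form_poly u H) \<beta> = 0")
    case True
    then show ?thesis using C_const_nonneg[of H] u by simp
  next
    case False
    then show ?thesis using coeff_quad_form_poly_le[of u H \<beta>] hom_polyD[OF homq] by simp
  qed
  have "coeff (Ysum ^ N * quad_form_poly u H) \<alpha> > 0"
    by (rule polya_coeff_pos[OF homq bound _ N' \<alpha>])
       (simp add: eval_quad_form_poly succeq_on_mat_Const[OF lower])
  then show "u \<bullet> (coeff_mat (map_matrix ((*) (Ysum ^ N)) H) \<alpha> *v u) > 0"
    by (simp add: mult_quad_form_poly coeff_quad_form_poly)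
qed

section \<open>Representation of \<open>F\<close> by products of the linear forms\<close>

theorem theorem3p1:
  fixes L :: "'n::finite mpoly ^ 'm::finite"
    and P :: "(real ^ 'n) set"
    and F :: "'n mpoly ^ 't::finite ^ 't"
    and B :: "real ^ 'm ^ 'n"
    and R :: "nat \<Rightarrow> 'm mpoly" and s :: nat
    and c lambda :: real
    and Fbar :: "'m mpoly ^ 't ^ 't"
    and d N :: nat and C :: real
  assumes L_linear: "\<And>i. total_deg (L $ i) = 1"
    and L_sum: "(\<Sum>i\<in>UNIV. L $ i) = 1"
    and P_def: "P = {x. \<forall>i. eval_poly (L $ i) x \<ge> 0}"
    and P_convex: "convex P" and P_compact: "compact P" and P_interior: "interior P \<noteq> {}"
    and F_sym: "sym_mat F"
    and F_deg: "deg_mat F > 0"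
    and F_pos: "pos_def_on F P"
    and B: "\<And>i. pvar i = (\<Sum>j\<in>UNIV. Const (B $ i $ j) * L $ j)"
    and R_gen: "ideal_gen (R ` {1..s}) = {p. subst_poly L p = 0}"
    and R_sum: "\<exists>i\<in>{1..s}. R i = Ysum - 1"
    and Fbar: "Fbar = tilde B F + mat (Const c * (\<Sum>i=1..s. (R i)\<^sup>2))"
    and Fbar_pos: "pos_def_on Fbar std_simplex"
    and lambda_pos: "lambda > 0"
    and lambda: "succeq_on (homogenize Fbar) (mat (Const lambda)) std_simplex"
    and d: "d = deg_mat Fbar"
    and C: "C = C_const (homogenize Fbar)"
    and N: "real N > real d * (real d - 1) / 2 * (C / lambda) - real d"
  shows "\<exists>G :: ('m \<Rightarrow>\<^sub>0 nat) \<Rightarrow> real ^ 't ^ 't.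
           (\<forall>\<alpha>. expo_deg \<alpha> = N + d \<longrightarrow> sym_mat (G \<alpha>) \<and> pos_def (G \<alpha>)) \<and>
           F = (\<Sum>\<alpha> | expo_deg \<alpha> = N + d. poly_smult_mat (mpow L \<alpha>) (G \<alpha>))"
proof -
  define H where "H = homogenize Fbar"
  define G where "G = coeff_mat (map_matrix ((*) (Ysum ^ N)) H)"
  have hom: "hom_poly d (H $ i $ j)" for i j
    unfolding H_def d by (rule hom_poly_homogenize)
  have "sym_mat Fbar"
    using sym_mat_tilde[OF F_sym, of B] by (auto simp: Fbar sym_mat_nth mat_def)
  then have sym: "sym_mat H"
    unfolding H_def by (rule sym_mat_homogenize)
  have pos: "pos_def (G \<alpha>)" if "expo_deg \<alpha> = N + d" for \<alpha>
    unfolding G_def using lambda_pos lambda N that unfolding C H_def[symmetric]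
    by (intro polya_matrix[OF hom sym])
  \<comment> \<open>Each generator lies in the ideal, which is the kernel of the substitution; hence
    the term added to \<open>tilde B F\<close> in \<open>Fbar\<close> disappears.\<close>
  have "subst_poly L (R i) = 0" if "i \<in> {1..s}" for i
  proof -
    have "R i \<in> ideal_gen (R ` {1..s})"
      unfolding ideal_gen_def using that by (intro module.span_base[OF module_mpoly]) auto
    then show ?thesis using R_gen by simp
  qed
  then have "subst_poly L (mat (Const c * (\<Sum>i=1..s. (R i)\<^sup>2)) $ i $ j) = 0" for i j :: 't
    by (simp add: mat_def subst.insertion_mult subst.insertion_sum subst.insertion_power subst.insertion_0)
  then have Fbar_F: "subst_poly L (Fbar $ i $ j) = F $ i $ j" for i j
    by (simp add: Fbar subst.insertion_add subst_poly_tilde[OF L_sum B])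
  have "F $ i $ j = (\<Sum>\<alpha> | expo_deg \<alpha> = N + d. mpow L \<alpha> * Const (G \<alpha> $ i $ j))" for i j
  proof -
    \<comment> \<open>Homogeneity confines the exponents to degree exactly \<open>N + d\<close>, the
      index set of the claimed sum.\<close>
    have "hom_poly (N + d) (Ysum ^ N * H $ i $ j)"
      using hom_poly_mult[OF hom_poly_power[OF hom_poly_Ysum, of N] hom] by simp
    then have keys: "Poly_Mapping.keys (Ysum ^ N * H $ i $ j) \<subseteq> {\<alpha>. expo_deg \<alpha> = N + d}"
      by (auto simp: in_keys_coeff dest: hom_polyD)
    have fin: "finite {\<alpha> :: 'm \<Rightarrow>\<^sub>0 nat. expo_deg \<alpha> = N + d}"
      by (rule finite_subset[OF _ finite_expo_deg_le[of "N + d"]]) auto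
    \<comment> \<open>The substitution turns \<open>Ysum ^ N\<close> into 1, undoes the
      homogenization and sends \<open>Fbar\<close> to \<open>F\<close>.\<close>
    have "F $ i $ j = subst_poly L (Ysum ^ N * H $ i $ j)"
      by (simp add: subst.insertion_mult subst.insertion_power subst_poly_Ysum[OF L_sum]
          H_def subst_poly_homogenize[OF L_sum] Fbar_F)
    then show ?thesis
      unfolding subst.insertion_superset[OF fin keys] by (simp add: G_def mult.commute)
  qed
  then have "F = (\<Sum>\<alpha> | expo_deg \<alpha> = N + d. poly_smult_mat (mpow L \<alpha>) (G \<alpha>))"
    by (simp add: vec_eq_iff sum_nth_matrix)
  then show ?thesis
    using pos by (intro exI[of _ G]) (simp add: pos_def_def)
qed

end
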